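(* Let $p,m,N\ge1$, $K\in\{0,1,\dots,m\}$, $\gamma>0$, $\rho>0$, let $f,\phi:\mathbb R^N\to\mathbb R$ be continuously differentiable, and let $D$ be a real $pm\times N$ matrix. Suppose that the following assumptions hold: (A1) $D$ is surjective, that is, $\sigma:=\lambda_{\min}(DD^\top)>0$; (A2) $f$ is convex; (A3) $f+\phi$ is $L_1$-smooth; (A4) $f+\phi+\frac{\rho}{2}\|D\,\cdot\,\|_2^2$ is $\alpha_1$-strongly convex; (A5) $\phi$ is $L_2$-smooth and $\alpha_2$-strongly convex; (A6) there exists $0<r<1$ such that $\rho>\frac{2}{\sigma(\alpha_1+\alpha_2)}\left(\frac{L_1^2}{r}+\frac{L_2^2}{1-r}\right)$, where $L_1,L_2,\alpha_1,\alpha_2\ge 0$ are allowed to be $0$, but $\alpha_1+\alpha_2>0$. If a sequence $\{(\boldsymbol x^t,\boldsymbol z^t,\boldsymbol y^t)\}$ generated by Proximal ADMM (with parameter $\rho$ and function $\phi$) has a partial limit $(\boldsymbol x^*,\boldsymbol z^*,\boldsymbol y^* )$, i.e. some subsequence converges to it, then $\boldsymbol x^*$ is a local minimum of $$\underset{\boldsymbol x\in\mathbb R^N}{\text{minimize}}\quad f(\boldsymbol x)+\gamma T_K(D\boldsymbol x).$$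
   Context: For $L\ge0$, a differentiable function $g$ is $L$-smooth if $\|\nabla g(x)-\nabla g(y)\|_2\le L\|x-y\|_2$ for all $x,y$. For $\alpha\ge0$, $g$ is $\alpha$-strongly convex if $g-\frac{\alpha}{2}\|\cdot\|_2^2$ is convex (so $0$-strongly convex means convex). $\lambda_{\min}(A)$ is the smallest eigenvalue of a symmetric matrix $A$. Vectors $\boldsymbol z\in\mathbb R^{pm}$ are written in blocks $\boldsymbol z=(z_k)_{k\in[m]}$, $z_k\in\mathbb R^p$. $T_K(\boldsymbol z)=\|z_{(K+1)}\|_2+\cdots+\|z_{(m)}\|_2$, where $\|z_{(k)}\|_2$ is the $k$-th largest component of $(\|z_1\|_2,\dots,\|z_m\|_2)$; i.e. $T_K$ is the sum of the $m-K$ smallest block norms. Augmented Lagrangian: $L_\rho(\boldsymbol x,\boldsymbol z,\boldsymbol y)=f(\boldsymbol x)+\gamma T_K(\boldsymbol z)+\boldsymbol y^\top(\boldsymbol z-D\boldsymbol x)+\frac\rho2\|\boldsymbol z-D\boldsymbol x\|_2^2$ for $\boldsymbol x\in\mathbb R^N$, $\boldsymbol z,\boldsymbol y\in\mathbb R^{pm}$. Bregman distance: $B_\phi(\boldsymbol x,\boldsymbol x')=\phi(\boldsymbol x)-\phi(\boldsymbol x')-\nabla\phi(\boldsymbol x')^\top(\boldsymbol x-\boldsymbol x')$. Proximal ADMM: given arbitrary $\boldsymbol x^0\in\mathbb R^N$, $\boldsymbol y^0\in\mathbb R^{pm}$, for $t=0,1,2,\dots$ choose $$\boldsymbol z^{t+1}\in\operatorname{argmin}_{\boldsymbol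 z}L_\rho(\boldsymbol x^t,\boldsymbol z,\boldsymbol y^t),\quad \boldsymbol x^{t+1}\in\operatorname{argmin}_{\boldsymbol x}\{L_\rho(\boldsymbol x,\boldsymbol z^{t+1},\boldsymbol y^t)+B_\phi(\boldsymbol x,\boldsymbol x^t)\},\quad \boldsymbol y^{t+1}=\boldsymbol y^t+\rho(\boldsymbol z^{t+1}-D\boldsymbol x^{t+1}).$$ *)

theory Defs
  imports "HOL-Analysis.Analysis" "HOL-Library.Multiset"
begin

definition grad :: "('a::real_inner \<Rightarrow> real) \<Rightarrow> 'a \<Rightarrow> 'a" where
  "grad g x = (THE d. GDERIV g x :> d)"

definition cont_differentiable :: "('a::real_inner \<Rightarrow> real) \<Rightarrow> bool" where
  "cont_differentiable g \<longleftrightarrow> (\<forall>x. g differentiable (at x)) \<and> continuous_on UNIV (grad g)"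

(* lipschitz_on also demands L >= 0. *)
definition smooth_with :: "real \<Rightarrow> ('a::real_inner \<Rightarrow> real) \<Rightarrow> bool" where
  "smooth_with L g \<longleftrightarrow> (\<forall>x. g differentiable (at x)) \<and> L-lipschitz_on UNIV (grad g)"

definition strongly_convex :: "real \<Rightarrow> ('a::real_inner \<Rightarrow> real) \<Rightarrow> bool" where
  "strongly_convex \<alpha> g \<longleftrightarrow> convex_on UNIV (\<lambda>x. g x - \<alpha> / 2 * (norm x)\<^sup>2)"

(* Meant for symmetric A: the real eigenvalues then form a finite nonempty set,
   so the least one exists. *)
definition lambda_min :: "real ^ 'i ^ 'i::finite \<Rightarrow> real" where
  "lambda_min A = (LEAST l. \<exists>v. v \<noteq> 0 \<and> A *v v = l *\<^sub>R v)"

(* A vector of R^(p m), m = CARD('m), p = CARD('p), has its entries indexed by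
   (block, position in block). *)
definition block :: "real ^ ('m::finite \<times> 'p::finite) \<Rightarrow> 'm \<Rightarrow> real ^ 'p" where
  "block z k = (\<chi> i. z $ (k, i))"

definition block_norms_desc :: "real ^ ('m::finite \<times> 'p::finite) \<Rightarrow> real list" where
  "block_norms_desc z =
     rev (sorted_list_of_multiset (image_mset (\<lambda>k. norm (block z k)) (mset_set UNIV)))"

(* The k-th largest block norm, counted from k = 1, is entry k - 1 of the list. *)
definition T :: "nat \<Rightarrow> real ^ ('m::finite \<times> 'p::finite) \<Rightarrow> real" where
  "T K z = (\<Sum>k = K + 1..CARD('m). block_norms_desc z ! (k - 1))"

definition aug_lagrangian ::
  "(real ^ 'n \<Rightarrow> real) \<Rightarrow> real \<Rightarrow> nat \<Rightarrow> real ^ 'n ^ ('m::finite \<times> 'p::finite) \<Rightarrow> real \<Rightarrow>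
   real ^ 'n \<Rightarrow> real ^ ('m \<times> 'p) \<Rightarrow> real ^ ('m \<times> 'p) \<Rightarrow> real" where
  "aug_lagrangian f \<gamma> K D \<rho> x z y =
     f x + \<gamma> * T K z + y \<bullet> (z - D *v x) + \<rho> / 2 * (norm (z - D *v x))\<^sup>2"

definition bregman :: "('a::real_inner \<Rightarrow> real) \<Rightarrow> 'a \<Rightarrow> 'a \<Rightarrow> real" where
  "bregman \<phi> x x' = \<phi> x - \<phi> x' - grad \<phi> x' \<bullet> (x - x')"

(* z 0 is unconstrained: the iteration never uses it. *)
definition proximal_ADMM ::
  "(real ^ 'n \<Rightarrow> real) \<Rightarrow> (real ^ 'n \<Rightarrow> real) \<Rightarrow> real \<Rightarrow> nat \<Rightarrow>
   real ^ 'n ^ ('m::finite \<times> 'p::finite) \<Rightarrow> real \<Rightarrow>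
   (nat \<Rightarrow> real ^ 'n) \<Rightarrow> (nat \<Rightarrow> real ^ ('m \<times> 'p)) \<Rightarrow> (nat \<Rightarrow> real ^ ('m \<times> 'p)) \<Rightarrow> bool" where
  "proximal_ADMM f \<phi> \<gamma> K D \<rho> x z y \<longleftrightarrow>
     (\<forall>t. is_arg_min (\<lambda>w. aug_lagrangian f \<gamma> K D \<rho> (x t) w (y t)) (\<lambda>_. True) (z (Suc t)) \<and>
          is_arg_min (\<lambda>u. aug_lagrangian f \<gamma> K D \<rho> u (z (Suc t)) (y t) + bregman \<phi> u (x t))
            (\<lambda>_. True) (x (Suc t)) \<and>
          y (Suc t) = y t + \<rho> *\<^sub>R (z (Suc t) - D *v x (Suc t)))"

definition partial_limit :: "(nat \<Rightarrow> 'a::topological_space) \<Rightarrow> 'a \<Rightarrow> bool" where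
  "partial_limit X l \<longleftrightarrow> (\<exists>s. strict_mono s \<and> (X \<circ> s) \<longlonglongrightarrow> l)"

definition local_minimum :: "('a::metric_space \<Rightarrow> real) \<Rightarrow> 'a \<Rightarrow> bool" where
  "local_minimum F a \<longleftrightarrow> (\<exists>\<epsilon>>0. \<forall>x. dist x a < \<epsilon> \<longrightarrow> F a \<le> F x)"

end

theory Submission
  imports Defs
begin

text \<open>
Two facts carry the proof: the iteration forces a partial limit to be stationary, and stationarity
already implies local minimality, although \<open>T\<^sub>K\<close> is in general not convex.

Stationarity. Optimality in the \<open>x\<close>-step reads
\<open>D\<^sup>T y\<^sup>t\<^sup>+\<^sup>1 = \<nabla>f(x\<^sup>t\<^sup>+\<^sup>1) + \<nabla>\<phi>(x\<^sup>t\<^sup>+\<^sup>1) - \<nabla>\<phi>(x\<^sup>t)\<close> (\<open>transpose_dual\<close>). As \<open>D\<close> is surjective,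
multiplier steps are therefore bounded by the two latest \<open>x\<close>-steps (\<open>dual_step_le_primal_steps\<close>).
The \<open>z\<close>-step does not raise the augmented Lagrangian, the \<open>x\<close>-step lowers it by a multiple of
\<open>\<parallel>x\<^sup>t\<^sup>+\<^sup>1 - x\<^sup>t\<parallel>\<^sup>2\<close> thanks to strong convexity, and the multiplier step raises it by \<open>\<parallel>y\<^sup>t\<^sup>+\<^sup>1 - y\<^sup>t\<parallel>\<^sup>2 / \<rho>\<close>.
For \<open>\<rho>\<close> as large as assumed, the augmented Lagrangian plus a multiple of the last squared
\<open>x\<close>-step is a Lyapunov function (\<open>lyapunov_decrease\<close>). Along the convergent subsequence it stays
bounded below, so all \<open>x\<close>-steps, all multiplier steps and hence the residuals \<open>z - D x\<close> tend to 0.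
Consequently the iterates that follow the subsequence have \<open>x\<close> and \<open>y\<close> converging to the same limits
\<open>x\<^sup>*\<close> and \<open>y\<^sup>*\<close>, and \<open>z\<close> converging to \<open>D x\<^sup>*\<close>. Passing to the limit in both steps gives
\<open>\<nabla>f(x\<^sup>*) = D\<^sup>T y\<^sup>*\<close> (\<open>limit_gradient\<close>) and shows that \<open>D x\<^sup>*\<close> minimises
\<open>\<gamma> T\<^sub>K(w) + y\<^sup>* \<bullet> (w - D x\<^sup>*) + \<rho>/2 \<parallel>w - D x\<^sup>*\<parallel>\<^sup>2\<close> over \<open>w\<close> (\<open>limit_z_optimality\<close>).

Local minimality. \<open>T\<^sub>K\<close> is the minimum, over the sets \<open>S\<close> of \<open>m - K\<close> blocks, of the convex functions
\<open>\<Sum>k\<in>S. \<parallel>z\<^sub>k\<parallel>\<close>. Each piece active at \<open>D x\<^sup>*\<close> inherits the minimality just stated, and for a convex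
function the quadratic term can be dropped (\<open>convex_min_of_min_up_to_quadratic\<close>); so \<open>- y\<^sup>*\<close> is a
subgradient of \<open>\<gamma>\<close> times each active piece. Near \<open>D x\<^sup>*\<close> only active pieces matter
(\<open>T_eventually_active\<close>), so the first-order lower bounds for \<open>\<gamma> T\<^sub>K(D u)\<close> and for the convex \<open>f\<close>
both hold near \<open>x\<^sup>*\<close>, and their linear terms cancel (\<open>local_minimum_of_stationary\<close>).
\<close>

section \<open>Convexity and gradients\<close>

text \<open>
Along the segment from \<open>a\<close> to \<open>w\<close> the gain allowed by the quadratic is of second order in the
step length \<open>t\<close>, while convexity makes any decrease of \<open>g\<close> at least linear in \<open>t\<close>. Dividing by \<open>t\<close>
and letting \<open>t\<close> tend to 0 removes the quadratic. The lemma serves twice: for the quadratic growth of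
a strongly convex function around its minimum, and for discarding the penalty term from the limit
of the \<open>z\<close>-steps.
\<close>

lemma convex_min_of_min_up_to_quadratic:
  fixes g :: "'a::real_normed_vector \<Rightarrow> real"
  assumes conv: "convex_on UNIV g"
    and min: "\<And>w. g a \<le> g w + C * (norm (w - a))\<^sup>2"
  shows "g a \<le> g w"
proof -
  have step: "g a \<le> g w + C * t * (norm (w - a))\<^sup>2" if t: "0 < t" "t \<le> 1" for t
  proof -
    have "g a \<le> g ((1 - t) *\<^sub>R a + t *\<^sub>R w) + C * (norm ((1 - t) *\<^sub>R a + t *\<^sub>R w - a))\<^sup>2"
      by (rule min)
    also have "(1 - t) *\<^sub>R a + t *\<^sub>R w - a = t *\<^sub>R (w - a)"
      by (simp add: algebra_simps)
    also have "(norm (t *\<^sub>R (w - a)))\<^sup>2 = t\<^sup>2 * (norm (w - a))\<^sup>2"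
      by (simp add: power_mult_distrib)
    also have "g ((1 - t) *\<^sub>R a + t *\<^sub>R w) \<le> (1 - t) * g a + t * g w"
      using convex_onD[OF conv, of t a w] t by simp
    finally have "t * g a \<le> t * (g w + C * t * (norm (w - a))\<^sup>2)"
      by (simp add: algebra_simps power2_eq_square)
    with t show ?thesis by simp
  qed
  have "((\<lambda>t. g w + C * t * (norm (w - a))\<^sup>2) \<longlongrightarrow> g w + C * 0 * (norm (w - a))\<^sup>2) (at_right 0)"
    by (intro tendsto_intros)
  moreover have "\<forall>\<^sub>F t in at_right (0::real). g a \<le> g w + C * t * (norm (w - a))\<^sup>2"
    unfolding eventually_at_right_field using step by (intro exI[of _ 1]) auto
  ultimately show ?thesis
    using tendsto_lowerbound[of "\<lambda>t. g w + C * t * (norm (w - a))\<^sup>2" _ "at_right 0" "g a"] by simp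
qed

lemma strongly_convex_add_affine:
  assumes "strongly_convex \<alpha> g"
  shows "strongly_convex \<alpha> (\<lambda>u. g u + d \<bullet> u + c)"
proof -
  have "convex_on UNIV (\<lambda>u. (g u - \<alpha> / 2 * (norm u)\<^sup>2) + (d \<bullet> u + c))"
    using assms unfolding strongly_convex_def
    by (intro convex_on_add)
       (auto simp: convex_on_def algebra_simps inner_add_right simp flip: distrib_right)
  then show ?thesis
    by (simp add: strongly_convex_def algebra_simps)
qed

text \<open>
Moving the centre of the subtracted quadratic changes the function by an affine one only.
\<close>

lemma strongly_convex_recentre:
  fixes g :: "'a::real_inner \<Rightarrow> real"
  assumes "strongly_convex \<alpha> g"
  shows "convex_on UNIV (\<lambda>w. g w - \<alpha> / 2 * (norm (w - a))\<^sup>2)"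
proof -
  have "convex_on UNIV (\<lambda>w. g w + (\<alpha> *\<^sub>R a) \<bullet> w + (- \<alpha> / 2 * (norm a)\<^sup>2) - \<alpha> / 2 * (norm w)\<^sup>2)"
    using strongly_convex_add_affine[OF assms] unfolding strongly_convex_def by blast
  then show ?thesis
    by (simp add: power2_norm_eq_inner algebra_simps inner_diff_left inner_diff_right inner_commute)
qed

lemma strongly_convex_min_growth:
  fixes h :: "'a::real_inner \<Rightarrow> real"
  assumes "strongly_convex \<alpha> h" and "\<And>w. h u \<le> h w"
  shows "h u + \<alpha> / 2 * (norm (w - u))\<^sup>2 \<le> h w"
  using convex_min_of_min_up_to_quadratic[OF strongly_convex_recentre[OF assms(1), of u],
      of u "\<alpha> / 2" w] assms(2)
  by simp

lemma GDERIV_unique: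
  fixes g :: "'a::real_inner \<Rightarrow> real"
  assumes "GDERIV g x :> d" "GDERIV g x :> e"
  shows "d = e"
proof -
  have "(\<lambda>h. h \<bullet> d) = (\<lambda>h. h \<bullet> e)"
    using assms by (auto simp: gderiv_def intro: has_derivative_unique)
  then have "(d - e) \<bullet> d = (d - e) \<bullet> e" by metis
  then show ?thesis
    by (metis eq_iff_diff_eq_0 inner_diff_right inner_eq_zero_iff)
qed

lemma GDERIV_grad:
  fixes g :: "'a::euclidean_space \<Rightarrow> real"
  assumes "g differentiable (at x)"
  shows "GDERIV g x :> grad g x"
proof -
  obtain g' where g': "(g has_derivative g') (at x)"
    using assms by (auto simp: differentiable_def)
  interpret bounded_linear g' by (rule has_derivative_bounded_linear[OF g'])
  have "g' = (\<lambda>h. h \<bullet> (\<Sum>b\<in>Basis. g' b *\<^sub>R b))"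
  proof
    fix h
    have "g' h = g' (\<Sum>b\<in>Basis. (h \<bullet> b) *\<^sub>R b)"
      by (simp add: euclidean_representation)
    also have "\<dots> = h \<bullet> (\<Sum>b\<in>Basis. g' b *\<^sub>R b)"
      by (simp add: sum scaleR inner_sum_right mult.commute)
    finally show "g' h = h \<bullet> (\<Sum>b\<in>Basis. g' b *\<^sub>R b)" .
  qed
  with g' have ex: "GDERIV g x :> (\<Sum>b\<in>Basis. g' b *\<^sub>R b)"
    by (simp add: gderiv_def)
  show ?thesis
    unfolding grad_def by (rule theI'[of "\<lambda>d. GDERIV g x :> d"]) (use ex GDERIV_unique in blast)
qed

lemma grad_eqI:
  fixes g :: "'a::euclidean_space \<Rightarrow> real"
  assumes "GDERIV g x :> d"
  shows "grad g x = d"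
  using assms GDERIV_grad[of g x] GDERIV_unique
  by (auto simp: gderiv_def differentiable_def)

text \<open>
Restricting \<open>g\<close> to the line through \<open>a\<close> and \<open>w\<close> reduces this to the tangent inequality for convex
functions of one variable.
\<close>

lemma convex_on_gradient_inequality:
  fixes g :: "'a::real_inner \<Rightarrow> real"
  assumes conv: "convex_on UNIV g" and d: "GDERIV g a :> d"
  shows "g a + d \<bullet> (w - a) \<le> g w"
proof -
  define q where "q = (\<lambda>t. g (a + t *\<^sub>R (w - a)))"
  have "convex_on UNIV q"
  proof (rule convex_onI)
    fix t s r :: real assume t: "0 < t" "t < 1"
    have "a + ((1 - t) *\<^sub>R s + t *\<^sub>R r) *\<^sub>R (w - a)
        = (1 - t) *\<^sub>R (a + s *\<^sub>R (w - a)) + t *\<^sub>R (a + r *\<^sub>R (w - a))"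
      by (simp add: algebra_simps)
    then show "q ((1 - t) *\<^sub>R s + t *\<^sub>R r) \<le> (1 - t) * q s + t * q r"
      unfolding q_def using convex_onD[OF conv, of t] t by simp
  qed auto
  moreover have "(q has_real_derivative (d \<bullet> (w - a))) (at 0)"
  proof -
    have g': "(g has_derivative (\<lambda>h. h \<bullet> d)) (at (a + 0 *\<^sub>R (w - a)))"
      using d by (simp add: gderiv_def)
    have "((\<lambda>t. a + t *\<^sub>R (w - a)) has_derivative (\<lambda>t. t *\<^sub>R (w - a))) (at (0::real))"
      by (auto intro!: derivative_eq_intros)
    from has_derivative_compose[OF this g'] show ?thesis
      unfolding q_def has_field_derivative_def
      by (simp add: inner_commute mult.commute[of _ "d \<bullet> (w - a)"])
  qed
  ultimately have "q 1 - q 0 \<ge> (d \<bullet> (w - a)) * (1 - 0)"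
    by (intro convex_on_imp_above_tangent[of UNIV]) auto
  then show ?thesis by (simp add: q_def)
qed

text \<open>
Subtracting the quadratic centred at \<open>v\<close> keeps \<open>\<phi>\<close> convex and, since that quadratic is stationary at
\<open>v\<close>, does not change the gradient there; the bound is then the gradient inequality at \<open>v\<close>.
\<close>

lemma bregman_ge_quadratic:
  fixes \<phi> :: "'a::euclidean_space \<Rightarrow> real"
  assumes "strongly_convex \<alpha> \<phi>" and "\<phi> differentiable (at v)"
  shows "\<alpha> / 2 * (norm (u - v))\<^sup>2 \<le> bregman \<phi> u v"
proof -
  have "GDERIV (\<lambda>w. \<phi> w - \<alpha> / 2 * (norm (w - v))\<^sup>2) v :> grad \<phi> v"
    using GDERIV_grad[OF assms(2)] unfolding gderiv_def power2_norm_eq_inner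
    by (auto intro!: derivative_eq_intros)
  from convex_on_gradient_inequality[OF strongly_convex_recentre[OF assms(1)] this, of u]
  show ?thesis by (simp add: bregman_def)
qed

section \<open>The smallest eigenvalue\<close>

text \<open>
The Rayleigh quotient attains its minimum \<open>\<mu>\<close> on the unit sphere. At a minimiser \<open>v\<close> the nonnegative
quadratic form \<open>w \<bullet> A w - \<mu> (w \<bullet> w)\<close> vanishes, so its gradient vanishes there too, which says
\<open>A v = \<mu> v\<close>. Testing the Rayleigh bound on other eigenvectors shows that no eigenvalue lies below \<open>\<mu>\<close>.
\<close>

lemma lambda_min_symmetric:
  fixes A :: "real ^ 'i ^ 'i::finite"
  assumes sym: "transpose A = A"
  shows lambda_min_eigenvector: "\<exists>v. v \<noteq> 0 \<and> A *v v = lambda_min A *\<^sub>R v"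
    and lambda_min_le_rayleigh: "lambda_min A * (norm w)\<^sup>2 \<le> w \<bullet> (A *v w)"
proof -
  have "continuous_on (sphere 0 1) (\<lambda>v. v \<bullet> (A *v v))"
    by (intro continuous_intros)
  moreover have "sphere (0::real ^ 'i) 1 \<noteq> {}" by simp
  ultimately have "\<exists>v\<in>sphere 0 1. \<forall>w\<in>sphere 0 1. v \<bullet> (A *v v) \<le> w \<bullet> (A *v w)"
    by (rule continuous_attains_inf[OF compact_sphere, rotated])
  then obtain v where v: "norm v = 1"
    and vmin: "\<And>w. norm w = 1 \<Longrightarrow> v \<bullet> (A *v v) \<le> w \<bullet> (A *v w)"
    by auto
  define \<mu> where "\<mu> = v \<bullet> (A *v v)"
  have rayleigh: "\<mu> * (norm w)\<^sup>2 \<le> w \<bullet> (A *v w)" for w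
  proof (cases "w = 0")
    case False
    have "\<mu> \<le> (w /\<^sub>R norm w) \<bullet> (A *v (w /\<^sub>R norm w))"
      unfolding \<mu>_def by (rule vmin) (simp add: False)
    also have "\<dots> = (w \<bullet> (A *v w)) / (norm w)\<^sup>2"
      by (simp add: matrix_vector_mult_scaleR power2_eq_square divide_simps)
    finally show ?thesis using False by (simp add: pos_le_divide_eq)
  qed simp
  have symi: "h \<bullet> (A *v v) = v \<bullet> (A *v h)" for h
    by (metis dot_lmul_matrix inner_commute sym transpose_matrix_vector)
  have "((\<lambda>w. w \<bullet> (A *v w) - \<mu> * (w \<bullet> w)) has_derivative
      (\<lambda>h. 2 * (h \<bullet> (A *v v - \<mu> *\<^sub>R v)))) (at v)"
    by (rule derivative_eq_intros bounded_linear.has_derivative[OF matrix_vector_mul_bounded_linear] refl)+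
       (auto simp: symi inner_diff_right inner_commute algebra_simps)
  moreover have "\<forall>w. v \<bullet> (A *v v) - \<mu> * (v \<bullet> v) \<le> w \<bullet> (A *v w) - \<mu> * (w \<bullet> w)"
    using rayleigh v by (simp add: \<mu>_def power2_norm_eq_inner norm_eq_1)
  ultimately have "(\<lambda>h. 2 * (h \<bullet> (A *v v - \<mu> *\<^sub>R v))) = (\<lambda>h. 0)"
    by (intro has_derivative_local_min) auto
  then have "(A *v v - \<mu> *\<^sub>R v) \<bullet> (A *v v - \<mu> *\<^sub>R v) = 0"
    by (metis mult_eq_0_iff zero_neq_numeral)
  then have eig: "A *v v = \<mu> *\<^sub>R v" by simp
  have "lambda_min A = \<mu>"
    unfolding lambda_min_def
  proof (rule Least_equality)
    show "\<exists>v. v \<noteq> 0 \<and> A *v v = \<mu> *\<^sub>R v" using eig v by (intro exI[of _ v]) auto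
  next
    fix l assume "\<exists>w. w \<noteq> 0 \<and> A *v w = l *\<^sub>R w"
    then obtain w where "w \<noteq> 0" "A *v w = l *\<^sub>R w" by blast
    with rayleigh[of w] show "\<mu> \<le> l" by (simp add: power2_norm_eq_inner)
  qed
  then show "\<exists>v. v \<noteq> 0 \<and> A *v v = lambda_min A *\<^sub>R v" "lambda_min A * (norm w)\<^sup>2 \<le> w \<bullet> (A *v w)"
    using eig v rayleigh by (auto intro!: exI[of _ v])
qed

lemma inner_mult_transpose: "v \<bullet> ((D ** transpose D) *v v) = (norm (transpose D *v v))\<^sup>2"
  for D :: "real ^ 'n ^ 'i::finite"
  by (metis dot_lmul_matrix matrix_vector_mul_assoc power2_norm_eq_inner transpose_matrix_vector)

text \<open>
This is how surjectivity of \<open>D\<close> enters: a change of the multiplier \<open>y\<close> is controlled by the change of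
\<open>D\<^sup>T y\<close>, which the \<open>x\<close>-step expresses through gradients.
\<close>

lemma lambda_min_gram:
  fixes D :: "real ^ 'n ^ 'i::finite"
  shows lambda_min_le_norm_transpose:
      "lambda_min (D ** transpose D) * (norm v)\<^sup>2 \<le> (norm (transpose D *v v))\<^sup>2"
    and lambda_min_pos_of_surj: "surj ((*v) D) \<Longrightarrow> 0 < lambda_min (D ** transpose D)"
proof -
  have sym: "transpose (D ** transpose D) = D ** transpose D"
    by (simp add: matrix_transpose_mul)
  show "lambda_min (D ** transpose D) * (norm v)\<^sup>2 \<le> (norm (transpose D *v v))\<^sup>2"
    using lambda_min_le_rayleigh[OF sym, of v] by (simp add: inner_mult_transpose)
  assume surj: "surj ((*v) D)"
  obtain e where e: "e \<noteq> 0" "(D ** transpose D) *v e = lambda_min (D ** transpose D) *\<^sub>R e"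
    using lambda_min_eigenvector[OF sym] by blast
  obtain u where u: "e = D *v u" using surj by (metis surjD)
  have "transpose D *v e \<noteq> 0"
  proof
    assume "transpose D *v e = 0"
    then have "e \<bullet> (D *v u) = 0"
      by (metis dot_lmul_matrix inner_zero_left transpose_matrix_vector)
    with e u show False by simp
  qed
  then have "0 < lambda_min (D ** transpose D) * (norm e)\<^sup>2"
    using inner_mult_transpose[of e D] e(2) by (simp add: power2_norm_eq_inner)
  then show "0 < lambda_min (D ** transpose D)"
    by (simp add: zero_less_mult_iff)
qed

section \<open>The truncated sum as a minimum over block sets\<close>

abbreviation block_norm_sum :: "'m set \<Rightarrow> real ^ ('m::finite \<times> 'p::finite) \<Rightarrow> real" where
  "block_norm_sum S z \<equiv> \<Sum>k\<in>S. norm (block z k)"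

lemma block_linear: "linear (\<lambda>z. block z k)"
  by (rule linearI) (simp_all add: block_def vec_eq_iff)

lemma convex_on_block_norm_sum:
  fixes S :: "'m::finite set"
  shows "convex_on UNIV (\<lambda>z :: real ^ ('m \<times> 'p::finite). block_norm_sum S z)"
proof (rule convex_onI)
  fix t :: real and z w :: "real ^ ('m \<times> 'p)"
  assume t: "0 < t" "t < 1"
  have "norm (block ((1 - t) *\<^sub>R z + t *\<^sub>R w) k) \<le> (1 - t) * norm (block z k) + t * norm (block w k)"
    for k
    using t norm_triangle_ineq[of "(1 - t) *\<^sub>R block z k" "t *\<^sub>R block w k"]
    by (simp add: linear_add[OF block_linear] linear_scale[OF block_linear])
  then have "block_norm_sum S ((1 - t) *\<^sub>R z + t *\<^sub>R w)
      \<le> (\<Sum>k\<in>S. (1 - t) * norm (block z k) + t * norm (block w k))"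
    by (rule sum_mono)
  then show "block_norm_sum S ((1 - t) *\<^sub>R z + t *\<^sub>R w)
      \<le> (1 - t) * block_norm_sum S z + t * block_norm_sum S w"
    by (simp add: sum.distrib sum_distrib_left)
qed simp

lemma tendsto_block_norm_sum: "(block_norm_sum S \<longlongrightarrow> block_norm_sum S z) (nhds z)"
proof -
  have "isCont (\<lambda>z. block z k) z" for k
    by (intro linear_continuous_at linear_conv_bounded_linear[THEN iffD1] block_linear)
  then have "isCont (block_norm_sum S) z"
    by (intro continuous_intros)
  then show ?thesis
    unfolding isCont_def by (rule tendsto_at_iff_tendsto_nhds[THEN iffD1])
qed

text \<open>
After removing the common part, \<open>R - S\<close> and \<open>S - R\<close> have equally many elements, and the largest value
of \<open>g\<close> on \<open>R - S\<close> separates the values on the two sets.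
\<close>

lemma sum_le_sum_same_card:
  fixes g :: "'a \<Rightarrow> real"
  assumes fin: "finite S" "finite R" and card: "card S = card R"
    and le: "\<And>i j. i \<in> R \<Longrightarrow> j \<notin> R \<Longrightarrow> g i \<le> g j"
  shows "sum g R \<le> sum g S"
proof -
  have card_diff: "card (R - S) = card (S - R)"
    using card fin by (simp add: card_Diff_subset_Int Int_commute)
  have "sum g (R - S) \<le> sum g (S - R)"
  proof (cases "R - S = {}")
    case True
    then have "S - R = {}" using card_diff fin by (metis card_0_eq card.empty finite_Diff)
    with True show ?thesis by (metis order_refl)
  next
    case False
    define c where "c = Max (g ` (R - S))"
    obtain i where i: "i \<in> R" "c = g i"
      using Max_in[of "g ` (R - S)"] False fin unfolding c_def by blast
    have "sum g (R - S) \<le> of_nat (card (R - S)) * c"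
      by (rule sum_bounded_above) (use fin in \<open>auto simp: c_def\<close>)
    also have "\<dots> \<le> sum g (S - R)"
      unfolding card_diff by (rule sum_bounded_below) (use le i in auto)
    finally show ?thesis .
  qed
  then show ?thesis
    using sum.Int_Diff[of R g S] sum.Int_Diff[of S g R] fin by (simp add: Int_commute)
qed

text \<open>
Sorting the block indices themselves by norm, rather than only the norms, yields a set \<open>R\<close> of indices
that carries the \<open>K\<close>-truncated sum. With \<open>T_le_block_norm_sum\<close> it follows that \<open>T K\<close> is the minimum of
the convex functions \<open>block_norm_sum S\<close> over the sets \<open>S\<close> of \<open>m - K\<close> indices.
\<close>

lemma T_eq_smallest_blocks:
  fixes z :: "real ^ ('m::finite \<times> 'p::finite)"
  assumes K: "K \<le> CARD('m)"
  obtains R where "card R = CARD('m) - K" and "T K z = block_norm_sum R z"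
    and "\<And>i j. i \<in> R \<Longrightarrow> j \<notin> R \<Longrightarrow> norm (block z i) \<le> norm (block z j)"
proof -
  define g where "g = (\<lambda>k. norm (block z k))"
  obtain xs :: "'m list" where xs: "set xs = UNIV" "distinct xs"
    using finite_distinct_list[of "UNIV :: 'm set"] by auto
  define ks where "ks = sort_key g xs"
  have ks: "set ks = UNIV" "distinct ks" "sorted (map g ks)"
    using xs by (auto simp: ks_def)
  have len: "length ks = CARD('m)" using ks by (metis distinct_card)
  have "image_mset g (mset_set UNIV) = mset (map g ks)"
    using mset_set_set[OF ks(2)] ks(1) by simp
  then have "sorted_list_of_multiset (image_mset g (mset_set UNIV)) = map g ks"
    using ks(3) by (metis sorted_list_of_multiset_mset sorted_sort_id)
  then have desc: "block_norms_desc z = rev (map g ks)"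
    by (simp add: block_norms_desc_def g_def)
  define n where "n = CARD('m) - K"
  define R where "R = set (take n ks)"
  have n: "n \<le> length ks" by (simp add: n_def len)
  have bij: "bij_betw ((!) ks) {..<n} R"
    using bij_betw_nth[of "take n ks" "{..<n}" R] ks(2) n by (auto simp: R_def bij_betw_def inj_on_def image_def)
  \<comment> \<open>The descending list is the reversed ascending one, so its entry \<open>k - 1\<close> is entry \<open>m - k\<close> of \<open>ks\<close>.\<close>
  have "T K z = (\<Sum>k = K + 1..CARD('m). g (ks ! (CARD('m) - k)))"
    unfolding T_def desc by (intro sum.cong) (auto simp: rev_nth len)
  also have "\<dots> = (\<Sum>j<n. g (ks ! j))"
    using K by (intro sum.reindex_bij_witness[of _ "\<lambda>j. CARD('m) - j" "\<lambda>k. CARD('m) - k"]) (auto simp: n_def)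
  also have "\<dots> = sum g R"
    by (rule sum.reindex_bij_betw[OF bij])
  finally have T: "T K z = block_norm_sum R z" by (simp add: g_def)
  have "card R = CARD('m) - K"
    using bij_betw_same_card[OF bij] by (simp add: n_def)
  moreover have "norm (block z i) \<le> norm (block z j)" if ij: "i \<in> R" "j \<notin> R" for i j
  proof -
    have "sorted (map g (take n ks) @ map g (drop n ks))"
      using ks(3) by (metis append_take_drop_id map_append)
    moreover have "j \<in> set (drop n ks)"
      using ij(2) ks(1) unfolding R_def by (metis UNIV_I Un_iff append_take_drop_id set_append)
    ultimately show ?thesis using ij(1) by (auto simp: sorted_append R_def g_def)
  qed
  ultimately show thesis using that T by blast
qed

lemma T_le_block_norm_sum:
  fixes z :: "real ^ ('m::finite \<times> 'p::finite)"
  assumes "K \<le> CARD('m)" and "card S = CARD('m) - K"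
  shows "T K z \<le> block_norm_sum S z"
proof -
  obtain R where "card R = CARD('m) - K" "T K z = block_norm_sum R z"
    "\<And>i j. i \<in> R \<Longrightarrow> j \<notin> R \<Longrightarrow> norm (block z i) \<le> norm (block z j)"
    using T_eq_smallest_blocks[OF assms(1)] by metis
  then show ?thesis
    using sum_le_sum_same_card[of S R "\<lambda>k. norm (block z k)"] assms(2) by simp
qed

lemma T_nonneg:
  fixes z :: "real ^ ('m::finite \<times> 'p::finite)"
  assumes "K \<le> CARD('m)"
  shows "0 \<le> T K z"
  using T_eq_smallest_blocks[OF assms, of z] by (metis norm_ge_zero sum_nonneg)

text \<open>
A minimum of finitely many continuous functions is, near \<open>a\<close>, attained only by functions that attain
it at \<open>a\<close>: the others exceed the minimum at \<open>a\<close> strictly and, by continuity, still do so nearby. This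
is what replaces convexity of \<open>T K\<close>: locally it suffices to argue about each active convex piece.
\<close>

lemma T_eventually_active:
  fixes a :: "real ^ ('m::finite \<times> 'p::finite)"
  assumes K: "K \<le> CARD('m)"
  shows "\<forall>\<^sub>F z in nhds a. \<exists>S. card S = CARD('m) - K \<and> T K z = block_norm_sum S z
           \<and> T K a = block_norm_sum S a"
proof -
  obtain R where R: "card R = CARD('m) - K" "T K a = block_norm_sum R a"
    using T_eq_smallest_blocks[OF K] by metis
  have "\<forall>\<^sub>F z in nhds a. \<forall>S\<in>{S. block_norm_sum R a < block_norm_sum S a}.
      block_norm_sum R z < block_norm_sum S z"
  proof (rule eventually_ball_finite)
    show "\<forall>S\<in>{S. block_norm_sum R a < block_norm_sum S a}.
        \<forall>\<^sub>F z in nhds a. block_norm_sum R z < block_norm_sum S z"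
      using order_tendstoD(1)[OF tendsto_diff[OF tendsto_block_norm_sum tendsto_block_norm_sum], of 0]
      by auto
  qed simp
  then show ?thesis
  proof (rule eventually_mono)
    fix z assume z: "\<forall>S\<in>{S. block_norm_sum R a < block_norm_sum S a}.
      block_norm_sum R z < block_norm_sum S z"
    obtain S where S: "card S = CARD('m) - K" "T K z = block_norm_sum S z"
      using T_eq_smallest_blocks[OF K] by metis
    have "\<not> block_norm_sum R a < block_norm_sum S a"
      using z S T_le_block_norm_sum[OF K R(1), of z] by force
    then have "T K a = block_norm_sum S a"
      using R(2) T_le_block_norm_sum[OF K S(1), of a] by simp
    with S show "\<exists>S. card S = CARD('m) - K \<and> T K z = block_norm_sum S z
           \<and> T K a = block_norm_sum S a" by blast
  qed
qed

lemma tendsto_T: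
  fixes a :: "real ^ ('m::finite \<times> 'p::finite)"
  assumes K: "K \<le> CARD('m)"
  shows "(T K \<longlongrightarrow> T K a) (nhds a)"
proof (rule tendstoI)
  fix e :: real assume "0 < e"
  then have "\<forall>\<^sub>F z in nhds a. \<forall>S\<in>UNIV. dist (block_norm_sum S z) (block_norm_sum S a) < e"
    by (intro eventually_ball_finite ballI tendstoD[OF tendsto_block_norm_sum]) auto
  with T_eventually_active[OF K, of a] show "\<forall>\<^sub>F z in nhds a. dist (T K z) (T K a) < e"
    by eventually_elim (metis UNIV_I)
qed

section \<open>Limit conditions imply local minimality\<close>

lemma inner_transpose_matrix: "(transpose D *v v) \<bullet> u = v \<bullet> (D *v u)"
  for D :: "real ^ 'n ^ 'i::finite"
  by (metis dot_lmul_matrix transpose_matrix_vector)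

text \<open>
An active piece lies above \<open>T K\<close> and touches it at \<open>b\<close>, so it inherits the hypothesis on \<open>T K\<close>. Being
convex, it then satisfies the inequality without the quadratic term, that is, \<open>- v\<close> is a
subgradient of \<open>\<gamma> * block_norm_sum S\<close> at \<open>b\<close>.
\<close>

lemma prox_stationary_active_subgradient:
  fixes b :: "real ^ ('m::finite \<times> 'p::finite)"
  assumes K: "K \<le> CARD('m)" and "0 \<le> \<gamma>"
    and prox: "\<And>w. \<gamma> * T K b \<le> \<gamma> * T K w + v \<bullet> (w - b) + \<rho> / 2 * (norm (w - b))\<^sup>2"
    and S: "card S = CARD('m) - K" "T K b = block_norm_sum S b"
  shows "\<gamma> * T K b \<le> \<gamma> * block_norm_sum S w + v \<bullet> (w - b)"
proof -
  define g where "g = (\<lambda>w. \<gamma> * block_norm_sum S w + v \<bullet> (w - b))"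
  have "convex_on UNIV (\<lambda>w. v \<bullet> (w - b))"
    by (auto simp: convex_on_def algebra_simps inner_add_right inner_diff_right simp flip: distrib_right)
  then have conv: "convex_on UNIV g"
    unfolding g_def using \<open>0 \<le> \<gamma>\<close> convex_on_block_norm_sum[of S]
    by (intro convex_on_add convex_on_cmul)
  have "g b \<le> g w + \<rho> / 2 * (norm (w - b))\<^sup>2" for w
    using prox[of w] mult_left_mono[OF T_le_block_norm_sum[OF K S(1), of w] \<open>0 \<le> \<gamma>\<close>]
    by (simp add: g_def S(2))
  from convex_min_of_min_up_to_quadratic[OF conv this, of w] show ?thesis
    by (simp add: g_def S(2))
qed

text \<open>
At every \<open>u\<close> near \<open>a\<close> some piece active at \<open>D a\<close> computes \<open>T K (D u)\<close>, so \<open>\<gamma> * T K (D u)\<close> drops below its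
value at \<open>a\<close> by at most \<open>v \<bullet> D (u - a)\<close>. Convexity of \<open>f\<close> makes \<open>f\<close> rise by at least the same amount,
because the gradient of \<open>f\<close> at \<open>a\<close> is \<open>D\<^sup>T v\<close>.
\<close>

lemma local_minimum_of_stationary:
  fixes f :: "real ^ 'n \<Rightarrow> real"
    and D :: "real ^ 'n ^ ('m::finite \<times> 'p::finite)"
  assumes K: "K \<le> CARD('m)" and "0 \<le> \<gamma>"
    and conv: "convex_on UNIV f" and grad: "GDERIV f a :> transpose D *v v"
    and prox: "\<And>w. \<gamma> * T K (D *v a)
      \<le> \<gamma> * T K w + v \<bullet> (w - D *v a) + \<rho> / 2 * (norm (w - D *v a))\<^sup>2"
  shows "local_minimum (\<lambda>u. f u + \<gamma> * T K (D *v u)) a"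
proof -
  have "filterlim (\<lambda>u. D *v u) (nhds (D *v a)) (nhds a)"
    by (metis isCont_def matrix_vector_mult_linear_continuous_at tendsto_at_iff_tendsto_nhds)
  from eventually_compose_filterlim[OF T_eventually_active[OF K] this]
  have "\<forall>\<^sub>F u in nhds a. f a + \<gamma> * T K (D *v a) \<le> f u + \<gamma> * T K (D *v u)"
  proof (rule eventually_mono, elim exE conjE)
    fix u and S :: "'m set"
    assume S: "card S = CARD('m) - K" "T K (D *v u) = block_norm_sum S (D *v u)"
      "T K (D *v a) = block_norm_sum S (D *v a)"
    have "\<gamma> * T K (D *v a) \<le> \<gamma> * T K (D *v u) + v \<bullet> (D *v u - D *v a)"
      using prox_stationary_active_subgradient[OF K \<open>0 \<le> \<gamma>\<close> prox S(1,3)] S(2) by simp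
    moreover have "f a + v \<bullet> (D *v u - D *v a) \<le> f u"
      using convex_on_gradient_inequality[OF conv grad, of u]
      by (simp add: inner_transpose_matrix matrix_vector_mult_diff_distrib del: transpose_matrix_vector)
    ultimately show "f a + \<gamma> * T K (D *v a) \<le> f u + \<gamma> * T K (D *v u)" by linarith
  qed
  then show ?thesis
    unfolding local_minimum_def eventually_nhds_metric .
qed

section \<open>Descent of the augmented Lagrangian\<close>

text \<open>
The two sides differ by the square of \<open>(1 - r) a - r b\<close>, up to a positive factor. The weight \<open>r\<close> is the
one in the lower bound for \<open>\<rho>\<close>.
\<close>

lemma square_add_le_weighted:
  fixes a b r :: real
  assumes "0 < r" "r < 1"
  shows "(a + b)\<^sup>2 \<le> a\<^sup>2 / r + b\<^sup>2 / (1 - r)"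
proof -
  have "a\<^sup>2 / r + b\<^sup>2 / (1 - r) - (a + b)\<^sup>2 = ((1 - r) * a - r * b)\<^sup>2 / (r * (1 - r))"
    using assms by (simp add: divide_simps) (simp add: power2_eq_square algebra_simps)
  also have "\<dots> \<ge> 0" using assms by simp
  finally show ?thesis by simp
qed

text \<open>
The shift by one matches the estimates below, which hold only once two consecutive multipliers have
been produced by the algorithm: the initial \<open>y 0\<close> is arbitrary.
\<close>

lemma tendsto_zero_of_square_le:
  fixes v :: "nat \<Rightarrow> 'a::real_normed_vector"
  assumes B: "B \<longlonglongrightarrow> 0" and le: "\<And>t. (norm (v (Suc t)))\<^sup>2 \<le> B t"
  shows "v \<longlonglongrightarrow> 0"
proof -
  have "(\<lambda>t. sqrt (B t)) \<longlonglongrightarrow> 0"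
    using tendsto_real_sqrt[OF B] by simp
  moreover have "norm (v (Suc t)) \<le> sqrt (B t)" for t
    using le by (rule real_le_rsqrt)
  ultimately have "(\<lambda>t. v (Suc t)) \<longlonglongrightarrow> 0"
    by (intro Lim_null_comparison[of "\<lambda>t. v (Suc t)" "\<lambda>t. sqrt (B t)"]) auto
  then show ?thesis by (rule LIMSEQ_imp_Suc)
qed

text \<open>
Here \<open>\<sigma>\<close> is any positive constant that bounds \<open>D D\<^sup>T\<close> from below, and \<open>r\<close> is a fixed weight for which \<open>\<rho>\<close> is
large enough.
\<close>

locale proximal_ADMM_run =
  fixes f \<phi> :: "real ^ 'n \<Rightarrow> real"
    and D :: "real ^ 'n ^ ('m::finite \<times> 'p::finite)"
    and K :: nat
    and \<gamma> \<rho> \<sigma> L\<^sub>1 L\<^sub>2 \<alpha>\<^sub>1 \<alpha>\<^sub>2 r :: real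
    and x :: "nat \<Rightarrow> real ^ 'n"
    and z y :: "nat \<Rightarrow> real ^ ('m \<times> 'p)"
  assumes K: "K \<le> CARD('m)" and \<gamma>: "0 < \<gamma>" and \<rho>: "0 < \<rho>"
    and f: "cont_differentiable f" and \<phi>: "cont_differentiable \<phi>"
    and \<alpha>: "0 < \<alpha>\<^sub>1 + \<alpha>\<^sub>2"
    and \<sigma>: "0 < \<sigma>" "\<And>v. \<sigma> * (norm v)\<^sup>2 \<le> (norm (transpose D *v v))\<^sup>2"
    and smooth_sum: "smooth_with L\<^sub>1 (\<lambda>u. f u + \<phi> u)"
    and strong_sum: "strongly_convex \<alpha>\<^sub>1 (\<lambda>u. f u + \<phi> u + \<rho> / 2 * (norm (D *v u))\<^sup>2)"
    and smooth_\<phi>: "smooth_with L\<^sub>2 \<phi>" and strong_\<phi>: "strongly_convex \<alpha>\<^sub>2 \<phi>"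
    and r: "0 < r" "r < 1"
    and \<rho>_large: "\<rho> > 2 / (\<sigma> * (\<alpha>\<^sub>1 + \<alpha>\<^sub>2)) * (L\<^sub>1\<^sup>2 / r + L\<^sub>2\<^sup>2 / (1 - r))"
    and run: "proximal_ADMM f \<phi> \<gamma> K D \<rho> x z y"
begin

abbreviation L where "L \<equiv> aug_lagrangian f \<gamma> K D \<rho>"

lemma z_step: "L (x t) (z (Suc t)) (y t) \<le> L (x t) w (y t)"
  using run unfolding proximal_ADMM_def is_arg_min_linorder by blast

lemma x_step:
  "L (x (Suc t)) (z (Suc t)) (y t) + bregman \<phi> (x (Suc t)) (x t)
    \<le> L u (z (Suc t)) (y t) + bregman \<phi> u (x t)"
  using run unfolding proximal_ADMM_def is_arg_min_linorder by blast

lemma y_step: "y (Suc t) = y t + \<rho> *\<^sub>R (z (Suc t) - D *v x (Suc t))"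
  using run unfolding proximal_ADMM_def by blast

lemma GDERIV_f: "GDERIV f u :> grad f u" and GDERIV_\<phi>: "GDERIV \<phi> u :> grad \<phi> u"
  using f \<phi> by (simp_all add: cont_differentiable_def GDERIV_grad)

text \<open>
The vanishing gradient of the \<open>x\<close>-step, rewritten with the multiplier update, has \<open>y (Suc t)\<close> in place
of \<open>y t\<close> plus the penalty term.
\<close>

lemma transpose_dual:
  "transpose D *v y (Suc t) = grad f (x (Suc t)) + grad \<phi> (x (Suc t)) - grad \<phi> (x t)"
    (is "_ = ?g")
proof -
  define u where "u = x (Suc t)"
  have f': "(f has_derivative (\<lambda>h. h \<bullet> grad f u)) (at u)"
    and \<phi>': "(\<phi> has_derivative (\<lambda>h. h \<bullet> grad \<phi> u)) (at u)"
    using GDERIV_f GDERIV_\<phi> by (simp_all add: gderiv_def)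
  have "((\<lambda>u. L u (z (Suc t)) (y t) + bregman \<phi> u (x t)) has_derivative
      (\<lambda>h. h \<bullet> ?g - y (Suc t) \<bullet> (D *v h))) (at u)"
    unfolding aug_lagrangian_def bregman_def power2_norm_eq_inner
    by (rule derivative_eq_intros f' \<phi>' refl
          bounded_linear.has_derivative[OF matrix_vector_mul_bounded_linear])+
       (auto simp: y_step u_def[symmetric] inner_add_left inner_add_right inner_diff_left
          inner_diff_right inner_commute algebra_simps)
  then have "(\<lambda>h. h \<bullet> ?g - y (Suc t) \<bullet> (D *v h)) = (\<lambda>h. 0)"
    using x_step[of t] by (intro has_derivative_local_min) (auto simp: u_def)
  from fun_cong[OF this] have "h \<bullet> (?g - transpose D *v y (Suc t)) = 0" for h
    unfolding inner_diff_right[of h ?g] inner_commute[of h "transpose D *v y (Suc t)"]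
      inner_transpose_matrix .
  from this[of "?g - transpose D *v y (Suc t)"] show ?thesis by simp
qed

text \<open>
The objective of the \<open>x\<close>-step is the \<open>\<alpha>\<^sub>1\<close>-strongly convex function of the hypothesis plus an affine
function, which gives growth \<open>\<alpha>\<^sub>1 / 2\<close> around the minimiser; the Bregman term contributes \<open>\<alpha>\<^sub>2 / 2\<close> more.
\<close>

lemma x_step_decrease:
  "L (x (Suc t)) (z (Suc t)) (y t) + (\<alpha>\<^sub>1 + \<alpha>\<^sub>2) / 2 * (norm (x (Suc t) - x t))\<^sup>2
    \<le> L (x t) (z (Suc t)) (y t)"
proof -
  define d where "d = - (transpose D *v (y t + \<rho> *\<^sub>R z (Suc t))) - grad \<phi> (x t)"
  have d_inner: "u \<bullet> d = - (y t \<bullet> (D *v u)) - \<rho> * (z (Suc t) \<bullet> (D *v u)) - grad \<phi> (x t) \<bullet> u" for u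
    unfolding inner_commute[of u d]
    by (simp add: d_def inner_diff_left inner_transpose_matrix inner_add_left
        del: transpose_matrix_vector)
  define c where "c = \<gamma> * T K (z (Suc t)) + y t \<bullet> z (Suc t) + \<rho> / 2 * (norm (z (Suc t)))\<^sup>2
    - \<phi> (x t) + grad \<phi> (x t) \<bullet> x t"
  define h where "h = (\<lambda>u. L u (z (Suc t)) (y t) + bregman \<phi> u (x t))"
  have "h = (\<lambda>u. (f u + \<phi> u + \<rho> / 2 * (norm (D *v u))\<^sup>2) + d \<bullet> u + c)"
    unfolding h_def c_def aug_lagrangian_def bregman_def power2_norm_eq_inner
    by (rule ext)
       (simp add: d_inner inner_add_left inner_diff_left inner_diff_right inner_commute algebra_simps)
  then have "strongly_convex \<alpha>\<^sub>1 h"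
    using strongly_convex_add_affine[OF strong_sum] by simp
  then have "h (x (Suc t)) + \<alpha>\<^sub>1 / 2 * (norm (x t - x (Suc t)))\<^sup>2 \<le> h (x t)"
    by (rule strongly_convex_min_growth) (simp add: h_def x_step)
  moreover have "\<alpha>\<^sub>2 / 2 * (norm (x (Suc t) - x t))\<^sup>2 \<le> bregman \<phi> (x (Suc t)) (x t)"
    using \<phi> by (intro bregman_ge_quadratic strong_\<phi>) (simp add: cont_differentiable_def)
  ultimately show ?thesis
    by (simp add: h_def bregman_def norm_minus_commute algebra_simps add_divide_distrib)
qed

lemma y_step_increase:
  "L (x (Suc t)) (z (Suc t)) (y (Suc t))
    = L (x (Suc t)) (z (Suc t)) (y t) + (norm (y (Suc t) - y t))\<^sup>2 / \<rho>"
proof -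
  define w where "w = z (Suc t) - D *v x (Suc t)"
  have "(norm (y (Suc t) - y t))\<^sup>2 / \<rho> = \<rho> * (norm w)\<^sup>2"
    using \<rho> by (simp add: y_step w_def power_mult_distrib power2_eq_square)
  moreover have "y (Suc t) \<bullet> w = y t \<bullet> w + \<rho> * (norm w)\<^sup>2"
    by (simp add: y_step w_def inner_add_left power2_norm_eq_inner)
  ultimately show ?thesis
    unfolding aug_lagrangian_def w_def[symmetric] by simp
qed

text \<open>
By \<open>transpose_dual\<close>, the change of \<open>D\<^sup>T y\<close> is the change of \<open>\<nabla>(f + \<phi>)\<close> over the newest \<open>x\<close>-step minus the
change of \<open>\<nabla>\<phi>\<close> over the one before, and both gradients are Lipschitz.
\<close>

lemma dual_step_le_primal_steps:
  "\<sigma> * (norm (y (Suc (Suc t)) - y (Suc t)))\<^sup>2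
    \<le> L\<^sub>1\<^sup>2 / r * (norm (x (Suc (Suc t)) - x (Suc t)))\<^sup>2 + L\<^sub>2\<^sup>2 / (1 - r) * (norm (x (Suc t) - x t))\<^sup>2"
proof -
  define p where "p = (\<lambda>u. grad (\<lambda>u. f u + \<phi> u) u)"
  have p: "p u = grad f u + grad \<phi> u" for u
    unfolding p_def by (intro grad_eqI GDERIV_add GDERIV_f GDERIV_\<phi>)
  have lip1: "norm (p u - p v) \<le> L\<^sub>1 * norm (u - v)" for u v
    using smooth_sum unfolding smooth_with_def p_def by (auto simp: lipschitz_on_def dist_norm)
  have lip2: "norm (grad \<phi> u - grad \<phi> v) \<le> L\<^sub>2 * norm (u - v)" for u v
    using smooth_\<phi> unfolding smooth_with_def by (auto simp: lipschitz_on_def dist_norm)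
  have "transpose D *v (y (Suc (Suc t)) - y (Suc t))
      = (p (x (Suc (Suc t))) - p (x (Suc t))) - (grad \<phi> (x (Suc t)) - grad \<phi> (x t))"
    by (simp add: matrix_vector_mult_diff_distrib transpose_dual p del: transpose_matrix_vector)
  then have "norm (transpose D *v (y (Suc (Suc t)) - y (Suc t)))
      \<le> L\<^sub>1 * norm (x (Suc (Suc t)) - x (Suc t)) + L\<^sub>2 * norm (x (Suc t) - x t)"
    by (simp only:) (rule order_trans[OF norm_triangle_ineq4 add_mono[OF lip1 lip2]])
  then have "(norm (transpose D *v (y (Suc (Suc t)) - y (Suc t))))\<^sup>2
      \<le> (L\<^sub>1 * norm (x (Suc (Suc t)) - x (Suc t)) + L\<^sub>2 * norm (x (Suc t) - x t))\<^sup>2"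
    by (intro power_mono) auto
  also have "\<dots> \<le> (L\<^sub>1 * norm (x (Suc (Suc t)) - x (Suc t)))\<^sup>2 / r
      + (L\<^sub>2 * norm (x (Suc t) - x t))\<^sup>2 / (1 - r)"
    by (rule square_add_le_weighted[OF r])
  finally show ?thesis
    using \<sigma>(2)[of "y (Suc (Suc t)) - y (Suc t)"] by (simp add: power_mult_distrib)
qed

text \<open>
The augmented Lagrangian alone need not decrease, because the multiplier step raises it and the
bound for this increase involves the previous \<open>x\<close>-step. Adding a matching multiple of the squared previous step lets that
increase be paid from the step before. The index is shifted so that only multipliers produced by the
algorithm occur.
\<close>

definition lyapunov :: "nat \<Rightarrow> real" where
  "lyapunov t = L (x (Suc t)) (z (Suc t)) (y (Suc t))
     + L\<^sub>2\<^sup>2 / (1 - r) / (\<rho> * \<sigma>) * (norm (x (Suc t) - x t))\<^sup>2"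

text \<open>
The constant \<open>c\<close> is what remains of the strong convexity modulus after paying for the multiplier
steps; the lower bound on \<open>\<rho>\<close> says exactly that it is positive.
\<close>

lemma lyapunov_decrease:
  obtains c where "0 < c"
    and "\<And>t. lyapunov (Suc t) + c * (norm (x (Suc (Suc t)) - x (Suc t)))\<^sup>2 \<le> lyapunov t"
proof -
  define Q where "Q = L\<^sub>1\<^sup>2 / r + L\<^sub>2\<^sup>2 / (1 - r)"
  define c where "c = (\<alpha>\<^sub>1 + \<alpha>\<^sub>2) / 2 - Q / (\<rho> * \<sigma>)"
  have "2 * Q < \<rho> * (\<sigma> * (\<alpha>\<^sub>1 + \<alpha>\<^sub>2))"
    using \<rho>_large \<sigma>(1) \<alpha>
    by (intro pos_divide_less_eq[THEN iffD1]) (auto simp: Q_def)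
  then have "Q < (\<alpha>\<^sub>1 + \<alpha>\<^sub>2) / 2 * (\<rho> * \<sigma>)"
    by (simp add: mult_ac)
  then have "Q / (\<rho> * \<sigma>) < (\<alpha>\<^sub>1 + \<alpha>\<^sub>2) / 2"
    using \<rho> \<sigma>(1) by (subst pos_divide_less_eq) auto
  then have "0 < c" by (simp add: c_def)
  moreover have "lyapunov (Suc t) + c * (norm (x (Suc (Suc t)) - x (Suc t)))\<^sup>2 \<le> lyapunov t" for t
  proof -
    define a where "a = (norm (x (Suc t) - x t))\<^sup>2"
    define b where "b = (norm (x (Suc (Suc t)) - x (Suc t)))\<^sup>2"
    have "(norm (y (Suc (Suc t)) - y (Suc t)))\<^sup>2 / \<rho>
        = \<sigma> * (norm (y (Suc (Suc t)) - y (Suc t)))\<^sup>2 / (\<rho> * \<sigma>)"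
      using \<sigma>(1) by simp
    also have "\<dots> \<le> (L\<^sub>1\<^sup>2 / r * b + L\<^sub>2\<^sup>2 / (1 - r) * a) / (\<rho> * \<sigma>)"
      using dual_step_le_primal_steps[of t] \<rho> \<sigma>(1)
      unfolding a_def b_def by (intro divide_right_mono) auto
    finally have "L (x (Suc (Suc t))) (z (Suc (Suc t))) (y (Suc (Suc t))) + (\<alpha>\<^sub>1 + \<alpha>\<^sub>2) / 2 * b
        \<le> L (x (Suc t)) (z (Suc t)) (y (Suc t))
          + (L\<^sub>1\<^sup>2 / r * b + L\<^sub>2\<^sup>2 / (1 - r) * a) / (\<rho> * \<sigma>)"
      using x_step_decrease[of "Suc t"] y_step_increase[of "Suc t"] z_step[of "Suc t" "z (Suc t)"]
      unfolding b_def by linarith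
    moreover have "c * b = (\<alpha>\<^sub>1 + \<alpha>\<^sub>2) / 2 * b - L\<^sub>1\<^sup>2 / r * b / (\<rho> * \<sigma>)
        - L\<^sub>2\<^sup>2 / (1 - r) / (\<rho> * \<sigma>) * b"
      by (simp add: c_def Q_def left_diff_distrib distrib_right add_divide_distrib)
    ultimately show ?thesis
      unfolding lyapunov_def a_def[symmetric] b_def[symmetric]
      by (simp add: add_divide_distrib)
  qed
  ultimately show thesis by (rule that)
qed

section \<open>Passing to the limit\<close>

lemma lyapunov_ge:
  "f (x (Suc t)) + y (Suc t) \<bullet> (z (Suc t) - D *v x (Suc t)) \<le> lyapunov t"
proof -
  have "0 \<le> \<gamma> * T K (z (Suc t))"
    by (intro mult_nonneg_nonneg less_imp_le[OF \<gamma>] T_nonneg K)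
  moreover have "0 \<le> \<rho> / 2 * (norm (z (Suc t) - D *v x (Suc t)))\<^sup>2"
    "0 \<le> L\<^sub>2\<^sup>2 / (1 - r) / (\<rho> * \<sigma>) * (norm (x (Suc t) - x t))\<^sup>2"
    using \<rho> \<sigma>(1) r by simp_all
  ultimately show ?thesis unfolding lyapunov_def aug_lagrangian_def by linarith
qed

lemma isCont_f: "isCont f u"
  using GDERIV_f[of u] by (auto simp: gderiv_def intro: has_derivative_continuous)

lemma isCont_grad_f: "isCont (grad f) u" and isCont_grad_\<phi>: "isCont (grad \<phi>) u"
  using f \<phi> by (auto simp: cont_differentiable_def continuous_on_eq_continuous_at)

context
  fixes s :: "nat \<Rightarrow> nat" and x' :: "real ^ 'n" and z' y' :: "real ^ ('m \<times> 'p)"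
  assumes s: "strict_mono s"
    and x_lim: "(\<lambda>k. x (s k)) \<longlonglongrightarrow> x'"
    and z_lim: "(\<lambda>k. z (s k)) \<longlonglongrightarrow> z'"
    and y_lim: "(\<lambda>k. y (s k)) \<longlonglongrightarrow> y'"
begin

text \<open>
The decreasing Lyapunov sequence is bounded below, since along the subsequence it dominates
quantities that converge. Hence it converges, and its decrements bound the squared \<open>x\<close>-steps.
\<close>

lemma primal_steps_vanish: "(\<lambda>t. x (Suc t) - x t) \<longlonglongrightarrow> 0"
proof -
  obtain c where c: "0 < c"
    and dec: "\<And>t. lyapunov (Suc t) + c * (norm (x (Suc (Suc t)) - x (Suc t)))\<^sup>2 \<le> lyapunov t"
    using lyapunov_decrease by blast
  have "lyapunov (Suc t) \<le> lyapunov t" for t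
    using dec[of t] c by (smt (verit) mult_nonneg_nonneg zero_le_power2)
  then have anti: "decseq lyapunov" by (simp add: decseq_Suc_iff)
  have "(\<lambda>k. f (x (s k)) + y (s k) \<bullet> (z (s k) - D *v x (s k))) \<longlonglongrightarrow> f x' + y' \<bullet> (z' - D *v x')"
    by (intro tendsto_intros isCont_tendsto_compose[OF isCont_f] x_lim y_lim z_lim
        isCont_tendsto_compose[OF matrix_vector_mult_linear_continuous_at])
  then have "Bseq (\<lambda>k. f (x (s k)) + y (s k) \<bullet> (z (s k) - D *v x (s k)))"
    by (rule convergent_imp_Bseq[OF convergentI])
  then obtain B where B: "\<And>k. \<bar>f (x (s k)) + y (s k) \<bullet> (z (s k) - D *v x (s k))\<bar> \<le> B"
    by (auto simp: Bseq_def)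
  \<comment> \<open>The bound at indices of the subsequence carries over to all \<open>t\<close>, as each \<open>t\<close> lies before one of them.\<close>
  have "- B \<le> lyapunov t" for t
  proof -
    have "Suc t \<le> s (Suc t)" by (rule seq_suble[OF s])
    then obtain n where n: "s (Suc t) = Suc n" "t \<le> n" by (cases "s (Suc t)") auto
    have "- B \<le> lyapunov n"
      using lyapunov_ge[of n] B[of "Suc t"] n(1) by simp
    also have "\<dots> \<le> lyapunov t" using anti n(2) by (simp add: decseqD)
    finally show ?thesis .
  qed
  then obtain M where "lyapunov \<longlonglongrightarrow> M"
    using decseq_convergent[OF anti, of "- B"] by blast
  then have "(\<lambda>t. (lyapunov t - lyapunov (Suc t)) / c) \<longlonglongrightarrow> (M - M) / c"
    using c by (intro tendsto_intros LIMSEQ_Suc) auto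
  then have "(\<lambda>t. (lyapunov t - lyapunov (Suc t)) / c) \<longlonglongrightarrow> 0" by simp
  then show ?thesis
  proof (rule tendsto_zero_of_square_le)
    fix t
    show "(norm (x (Suc (Suc t)) - x (Suc t)))\<^sup>2 \<le> (lyapunov t - lyapunov (Suc t)) / c"
      using dec[of t] c by (subst pos_le_divide_eq) (auto simp: mult.commute)
  qed
qed

lemma dual_steps_vanish: "(\<lambda>t. y (Suc t) - y t) \<longlonglongrightarrow> 0"
proof -
  define B where "B = (\<lambda>t. (L\<^sub>1\<^sup>2 / r * (norm (x (Suc (Suc t)) - x (Suc t)))\<^sup>2
    + L\<^sub>2\<^sup>2 / (1 - r) * (norm (x (Suc t) - x t))\<^sup>2) / \<sigma>)"
  have "B \<longlonglongrightarrow> (L\<^sub>1\<^sup>2 / r * (norm (0 :: real ^ 'n))\<^sup>2 + L\<^sub>2\<^sup>2 / (1 - r) * (norm (0 :: real ^ 'n))\<^sup>2) / \<sigma>"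
    unfolding B_def using \<sigma>(1)
    by (intro tendsto_intros primal_steps_vanish LIMSEQ_Suc[OF primal_steps_vanish]) auto
  then have "B \<longlonglongrightarrow> 0" by simp
  then show ?thesis
  proof (rule tendsto_zero_of_square_le)
    fix t
    show "(norm (y (Suc (Suc t)) - y (Suc t)))\<^sup>2 \<le> B t"
      unfolding B_def using dual_step_le_primal_steps[of t] \<sigma>(1)
      by (subst pos_le_divide_eq) (auto simp: mult.commute)
  qed
qed

lemma x_next_lim: "(\<lambda>k. x (Suc (s k))) \<longlonglongrightarrow> x'"
  using tendsto_add[OF x_lim LIMSEQ_subseq_LIMSEQ[OF primal_steps_vanish s]] by (simp add: o_def)

lemma y_next_lim: "(\<lambda>k. y (Suc (s k))) \<longlonglongrightarrow> y'"
  using tendsto_add[OF y_lim LIMSEQ_subseq_LIMSEQ[OF dual_steps_vanish s]] by (simp add: o_def)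

text \<open>
By the multiplier update the residual \<open>z (Suc t) - D x (Suc t)\<close> is a multiple of the multiplier step,
so it vanishes in the limit.
\<close>

lemma z_next_lim: "(\<lambda>k. z (Suc (s k))) \<longlonglongrightarrow> D *v x'"
proof -
  have "z (Suc t) = (1 / \<rho>) *\<^sub>R (y (Suc t) - y t) + D *v x (Suc t)" for t
    using \<rho> by (simp add: y_step)
  moreover have "(\<lambda>k. (1 / \<rho>) *\<^sub>R (y (Suc (s k)) - y (s k)) + D *v x (Suc (s k)))
      \<longlonglongrightarrow> (1 / \<rho>) *\<^sub>R 0 + D *v x'"
    using LIMSEQ_subseq_LIMSEQ[OF dual_steps_vanish s]
    by (intro tendsto_intros isCont_tendsto_compose[OF matrix_vector_mult_linear_continuous_at]
        x_next_lim) (auto simp: o_def)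
  ultimately show ?thesis by simp
qed

lemma limit_gradient: "grad f x' = transpose D *v y'"
proof -
  have "(\<lambda>k. transpose D *v y (Suc (s k))) \<longlonglongrightarrow> grad f x' + grad \<phi> x' - grad \<phi> x'"
    unfolding transpose_dual
    by (intro tendsto_intros isCont_tendsto_compose[OF isCont_grad_f]
        isCont_tendsto_compose[OF isCont_grad_\<phi>] x_lim x_next_lim)
  moreover have "(\<lambda>k. transpose D *v y (Suc (s k))) \<longlonglongrightarrow> transpose D *v y'"
    by (intro isCont_tendsto_compose[OF matrix_vector_mult_linear_continuous_at] y_next_lim)
  ultimately show ?thesis
    using LIMSEQ_unique by fastforce
qed

lemma limit_z_optimality:
  "\<gamma> * T K (D *v x') \<le> \<gamma> * T K w + y' \<bullet> (w - D *v x') + \<rho> / 2 * (norm (w - D *v x'))\<^sup>2"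
proof -
  have Dx: "(\<lambda>k. D *v x (s k)) \<longlonglongrightarrow> D *v x'"
    by (intro isCont_tendsto_compose[OF matrix_vector_mult_linear_continuous_at] x_lim)
  have lim: "(\<lambda>k. \<gamma> * T K (Z k) + y (s k) \<bullet> (Z k - D *v x (s k)) + \<rho> / 2 * (norm (Z k - D *v x (s k)))\<^sup>2)
      \<longlonglongrightarrow> \<gamma> * T K u + y' \<bullet> (u - D *v x') + \<rho> / 2 * (norm (u - D *v x'))\<^sup>2"
    if "Z \<longlonglongrightarrow> u" for Z u
    by (intro tendsto_intros y_lim Dx that filterlim_compose[OF tendsto_T[OF K] that])
  have "\<gamma> * T K (D *v x') + y' \<bullet> (D *v x' - D *v x') + \<rho> / 2 * (norm (D *v x' - D *v x'))\<^sup>2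
      \<le> \<gamma> * T K w + y' \<bullet> (w - D *v x') + \<rho> / 2 * (norm (w - D *v x'))\<^sup>2"
  proof (rule LIMSEQ_le[OF lim[OF z_next_lim] lim[OF tendsto_const]], intro exI allI impI)
    fix k
    show "\<gamma> * T K (z (Suc (s k))) + y (s k) \<bullet> (z (Suc (s k)) - D *v x (s k))
          + \<rho> / 2 * (norm (z (Suc (s k)) - D *v x (s k)))\<^sup>2
        \<le> \<gamma> * T K w + y (s k) \<bullet> (w - D *v x (s k)) + \<rho> / 2 * (norm (w - D *v x (s k)))\<^sup>2"
      using z_step[of "s k" w] by (simp add: aug_lagrangian_def)
  qed
  then show ?thesis by simp
qed

end

end

section \<open>Partial limits are local minima\<close>

theorem theorem3:
  fixes f \<phi> :: "real ^ 'n \<Rightarrow> real"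
    and D :: "real ^ 'n ^ ('m::finite \<times> 'p::finite)"
    and K :: nat
    and \<gamma> \<rho> \<sigma> L\<^sub>1 L\<^sub>2 \<alpha>\<^sub>1 \<alpha>\<^sub>2 :: real
    and x :: "nat \<Rightarrow> real ^ 'n"
    and z y :: "nat \<Rightarrow> real ^ ('m \<times> 'p)"
    and x' :: "real ^ 'n"
    and z' y' :: "real ^ ('m \<times> 'p)"
  assumes "K \<le> CARD('m)" and "\<gamma> > 0" and "\<rho> > 0"
    and "cont_differentiable f" and "cont_differentiable \<phi>"
    and "L\<^sub>1 \<ge> 0" and "L\<^sub>2 \<ge> 0" and "\<alpha>\<^sub>1 \<ge> 0" and "\<alpha>\<^sub>2 \<ge> 0" and "\<alpha>\<^sub>1 + \<alpha>\<^sub>2 > 0"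
    and \<sigma>_def: "\<sigma> = lambda_min (D ** transpose D)"
    and A1: "surj ((*v) D)"
    and A2: "convex_on UNIV f"
    and A3: "smooth_with L\<^sub>1 (\<lambda>u. f u + \<phi> u)"
    and A4: "strongly_convex \<alpha>\<^sub>1 (\<lambda>u. f u + \<phi> u + \<rho> / 2 * (norm (D *v u))\<^sup>2)"
    and A5: "smooth_with L\<^sub>2 \<phi>" "strongly_convex \<alpha>\<^sub>2 \<phi>"
    and A6: "\<exists>r. 0 < r \<and> r < 1 \<and>
               \<rho> > 2 / (\<sigma> * (\<alpha>\<^sub>1 + \<alpha>\<^sub>2)) * (L\<^sub>1\<^sup>2 / r + L\<^sub>2\<^sup>2 / (1 - r))"
    and "proximal_ADMM f \<phi> \<gamma> K D \<rho> x z y"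
    and "partial_limit (\<lambda>t. (x t, z t, y t)) (x', z', y')"
  shows "local_minimum (\<lambda>u. f u + \<gamma> * T K (D *v u)) x'"
proof -
  obtain r where r: "0 < r" "r < 1"
    "\<rho> > 2 / (\<sigma> * (\<alpha>\<^sub>1 + \<alpha>\<^sub>2)) * (L\<^sub>1\<^sup>2 / r + L\<^sub>2\<^sup>2 / (1 - r))"
    using A6 by blast
  interpret proximal_ADMM_run f \<phi> D K \<gamma> \<rho> \<sigma> L\<^sub>1 L\<^sub>2 \<alpha>\<^sub>1 \<alpha>\<^sub>2 r x z y
    using assms r lambda_min_le_norm_transpose[of D] lambda_min_pos_of_surj[OF A1]
    by unfold_locales auto
  obtain s where s: "strict_mono s"
    and lim: "(\<lambda>k. (x (s k), z (s k), y (s k))) \<longlonglongrightarrow> (x', z', y')"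
    using \<open>partial_limit _ _\<close> by (auto simp: partial_limit_def o_def)
  have xl: "(\<lambda>k. x (s k)) \<longlonglongrightarrow> x'" and zl: "(\<lambda>k. z (s k)) \<longlonglongrightarrow> z'"
    and yl: "(\<lambda>k. y (s k)) \<longlonglongrightarrow> y'"
    using tendsto_fst[OF lim] tendsto_fst[OF tendsto_snd[OF lim]]
      tendsto_snd[OF tendsto_snd[OF lim]] by simp_all
  have "GDERIV f x' :> transpose D *v y'"
    using GDERIV_f[of x'] limit_gradient[OF s xl zl yl] by simp
  with K less_imp_le[OF \<gamma>] A2 show ?thesis
    by (rule local_minimum_of_stationary) (rule limit_z_optimality[OF s xl zl yl])
qed

end
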